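(* Let $X$ be a locally convex topological vector space with dual $X^*$. Assume that the single-valued operator $T\colon \operatorname{dom} T\to X^*$, with nonempty domain $\operatorname{dom} T\subset X$, has a convex domain and that $T$ is continuous relative to any segment in $\operatorname{dom} T$. Then the local monotonicity of $T$ around any point of its graph is equivalent to the global monotonicity of $T$ on $X$; that is, $T$ is locally monotone around every point $(u,T(u))$, $u\in\operatorname{dom} T$, of its graph if and only if $T$ is (globally) monotone on $X$.
   Context: $X$ is a locally convex topological vector space, $X^*$ is its dual, and $\langle x^*,x\rangle$ is the value of $x^*\in X^*$ at $x\in X$. For $p,q\in X$, $[p,q]:=\{\lambda p+(1-\lambda)q : 0\le\lambda\le 1\}$ is the segment connecting $p$ and $q$; $T$ being continuous relative to any segment in $\operatorname{dom} T$ means that, for all $p,q$ with $[p,q]\subset\operatorname{dom} T$, the restriction of $T$ to $[p,q]$ is continuous. The graph of $T$ is $\operatorname{gph}T=\{(x,T(x)) : x\in\operatorname{dom}T\}\subset X\times X^*$. $T$ is (globally) monotone on $X$ if $\langle x^*-y^*,x-y\rangle\ge 0$ whenever $(x,x^* ),(y,y^* )\in\operatorname{gph}T$. $T$ is locally monotone around $(u,u^* )\in\operatorname{gph}T$ if there exists a neighborhood $W\subset X\times X^*$ of $(u,u^* )$ such that $\langle x^*-y^*,x-y\rangle\ge 0$ for all $(x,x^* ),(y,y^* )\in\operatorname{gph}T\cap W$. *)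

theory Defs
  imports "HOL-Analysis.Analysis"
begin

(* Real locally convex spaces; the Hausdorff axiom is not part of the class.
   The last conjunct of convex_nhds_0 is convex V, unfolded because the constant cannot be used
   inside the class specification. *)
class locally_convex_space = real_vector + topological_ab_group_add +
  assumes tendsto_scaleR_Pair:
    "LIM x (nhds a \<times>\<^sub>F nhds b). fst x *\<^sub>R snd x :> nhds (a *\<^sub>R b)"
  and convex_nhds_0:
    "open U \<Longrightarrow> 0 \<in> U \<Longrightarrow>
      \<exists>V. open V \<and> 0 \<in> V \<and> V \<subseteq> U \<and>
        (\<forall>x\<in>V. \<forall>y\<in>V. \<forall>u\<ge>0. \<forall>v\<ge>0. u + v = 1 \<longrightarrow> u *\<^sub>R x + v *\<^sub>R y \<in> V)"

instance real_normed_vector \<subseteq> locally_convex_space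
proof
  fix a :: real and b :: 'a
  show "LIM x (nhds a \<times>\<^sub>F nhds b). fst x *\<^sub>R snd x :> nhds (a *\<^sub>R b)"
    by (intro tendsto_scaleR filterlim_fst filterlim_snd)
next
  fix U :: "'a set"
  assume "open U" "0 \<in> U"
  then obtain e where "e > 0" "ball 0 e \<subseteq> U"
    by (meson open_contains_ball)
  moreover have "convex (ball (0::'a) e)"
    by (rule convex_ball)
  ultimately show "\<exists>V. open V \<and> 0 \<in> V \<and> V \<subseteq> U \<and>
      (\<forall>x\<in>V. \<forall>y\<in>V. \<forall>u\<ge>0. \<forall>v\<ge>0. u + v = 1 \<longrightarrow> u *\<^sub>R x + v *\<^sub>R y \<in> V)"
    by (intro exI[of _ "ball 0 e"] conjI) (simp_all add: convex_def)
qed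

definition topological_dual :: "('a::locally_convex_space \<Rightarrow> real) set" where
  "topological_dual = {f. linear f \<and> continuous_on UNIV f}"

definition weak_star_topology :: "('a::locally_convex_space \<Rightarrow> real) topology" where
  "weak_star_topology =
     subtopology (product_topology (\<lambda>_. euclideanreal) UNIV) topological_dual"

definition von_neumann_bounded :: "'a::locally_convex_space set \<Rightarrow> bool" where
  "von_neumann_bounded B \<longleftrightarrow>
     (\<forall>U. open U \<and> 0 \<in> U \<longrightarrow> (\<exists>r>0. \<forall>s::real. r \<le> \<bar>s\<bar> \<longrightarrow> B \<subseteq> (\<lambda>x. s *\<^sub>R x) ` U))"

(* Uniform convergence on bounded sets, generated by the open balls of the seminorms
   f \<mapsto> SUP x\<in>B. \<bar>f x\<bar> with B bounded (these suprema are finite on the dual).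
   On a normed space this is the topology of the dual norm. *)
definition strong_dual_topology :: "('a::locally_convex_space \<Rightarrow> real) topology" where
  "strong_dual_topology = topology_generated_by
     {{g \<in> topological_dual. (SUP x\<in>B. \<bar>g x - f x\<bar>) < e} | B f e.
        von_neumann_bounded B \<and> B \<noteq> {} \<and> f \<in> topological_dual \<and> 0 < e}"

lemma topspace_weak_star_topology [simp]:
  "topspace weak_star_topology = topological_dual"
  by (simp add: weak_star_topology_def)

lemma topspace_strong_dual_topology [simp]:
  "topspace strong_dual_topology = (topological_dual :: ('a::locally_convex_space \<Rightarrow> real) set)"
proof -
  let ?G = "{{g \<in> topological_dual. (SUP x\<in>B. \<bar>g x - f x\<bar>) < e} | (B :: 'a set) f e.
        von_neumann_bounded B \<and> B \<noteq> {} \<and> f \<in> topological_dual \<and> 0 < e}"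
  have b: "von_neumann_bounded {0::'a}"
    unfolding von_neumann_bounded_def by (auto intro!: exI[of _ 1] image_eqI[of _ _ 0])
  have "g \<in> \<Union>?G" if g: "g \<in> topological_dual" for g :: "'a \<Rightarrow> real"
  proof
    show "g \<in> {h \<in> topological_dual. (SUP x\<in>{0}. \<bar>h x - g x\<bar>) < 1}"
      using g by simp
    show "{h \<in> topological_dual. (SUP x\<in>{0}. \<bar>h x - g x\<bar>) < 1} \<in> ?G"
      using g b by (intro CollectI exI[of _ "{0}"] exI[of _ g] exI[of _ 1]) auto
  qed
  then have "\<Union>?G = topological_dual" by blast
  then show ?thesis
    by (simp add: strong_dual_topology_def topology_generated_by_topspace)
qed

definition gph :: "'a set \<Rightarrow> ('a \<Rightarrow> 'b) \<Rightarrow> ('a \<times> 'b) set" where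
  "gph D T = {(x, T x) | x. x \<in> D}"

definition monotone_graph :: "('a::locally_convex_space \<times> ('a \<Rightarrow> real)) set \<Rightarrow> bool" where
  "monotone_graph G \<longleftrightarrow>
     (\<forall>x x' y y'. (x, x') \<in> G \<and> (y, y') \<in> G \<longrightarrow> (x' - y') (x - y) \<ge> 0)"

definition globally_monotone ::
    "'a::locally_convex_space set \<Rightarrow> ('a \<Rightarrow> 'a \<Rightarrow> real) \<Rightarrow> bool" where
  "globally_monotone D T \<longleftrightarrow> monotone_graph (gph D T)"

definition locally_monotone_around ::
    "('a \<Rightarrow> real) topology \<Rightarrow> 'a::locally_convex_space set \<Rightarrow> ('a \<Rightarrow> 'a \<Rightarrow> real)
      \<Rightarrow> 'a \<times> ('a \<Rightarrow> real) \<Rightarrow> bool" where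
  "locally_monotone_around \<tau> D T p \<longleftrightarrow>
     (\<exists>W. openin (prod_topology euclidean \<tau>) W \<and> p \<in> W \<and> monotone_graph (gph D T \<inter> W))"

definition continuous_on_segments ::
    "('a \<Rightarrow> real) topology \<Rightarrow> 'a::locally_convex_space set \<Rightarrow> ('a \<Rightarrow> 'a \<Rightarrow> real) \<Rightarrow> bool" where
  "continuous_on_segments \<tau> D T \<longleftrightarrow>
     (\<forall>p q. closed_segment p q \<subseteq> D \<longrightarrow> continuous_map (top_of_set (closed_segment p q)) \<tau> T)"

end

theory Submission
  imports Defs
begin

text \<open>
  Only the passage from local to global monotonicity has content. Fix \<open>x, y \<in> D\<close> and put
  \<open>\<gamma> t = x + t (y - x)\<close>. Monotonicity of \<open>T\<close> between two points \<open>\<gamma> s\<close> and \<open>\<gamma> t\<close> of the segment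
  is the same as monotonicity of the real function \<open>\<phi> t = \<langle>T (\<gamma> t), y - x\<rangle>\<close> between \<open>s\<close> and \<open>t\<close>,
  because \<open>\<gamma> t - \<gamma> s\<close> is the multiple \<open>(t - s) (y - x)\<close> of one fixed direction. As \<open>T\<close> is continuous
  on the segment, \<open>t \<mapsto> (\<gamma> t, T (\<gamma> t))\<close> is a continuous curve in the graph, so a neighbourhood in
  which the graph is monotone is not left for parameters close to a given one: \<open>\<phi>\<close> is locally
  increasing on \<open>[0,1]\<close> (\<open>locally_monotone_along_segment\<close>). By compactness of \<open>[0,1]\<close> a locally
  increasing function satisfies \<open>\<phi> 0 \<le> \<phi> 1\<close> (\<open>le_endpoints_if_locally_le\<close>), which is the
  monotonicity inequality for \<open>x\<close> and \<open>y\<close>.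

  The topology of the dual enters only through the continuity of that curve and through the fact
  that the whole dual is open, so the weak-star and the strong case need no separate treatment.
\<close>

text \<open>Bisection: the inequality is transitive along adjacent intervals, so if it failed for
  \<open>[a,b]\<close> it would fail for arbitrarily short intervals around some point.\<close>

lemma le_endpoints_if_locally_le:
  fixes f :: "real \<Rightarrow> 'b::preorder"
  assumes "a \<le> b"
    and loc: "\<And>t. t \<in> {a..b} \<Longrightarrow>
      \<exists>e>0. \<forall>u v. a \<le> u \<and> u \<le> t \<and> t \<le> v \<and> v \<le> b \<and> v - u < e \<longrightarrow> f u \<le> f v"
  shows "f a \<le> f b"
proof -
  \<comment> \<open>The bisection principle also offers intervals that stick out of \<open>[a,b]\<close>; guarding the
     inequality makes it vacuous for them.\<close>
  define P where "P u v \<longleftrightarrow> (a \<le> u \<and> v \<le> b \<longrightarrow> f u \<le> f v)" for u v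
  have "P a b"
  proof (rule Bolzano[OF \<open>a \<le> b\<close>])
    show "P u w" if "P u v" "P v w" "u \<le> v" "v \<le> w" for u v w
      using that unfolding P_def by (meson order_trans)
    show "\<exists>d>0. \<forall>u v. u \<le> t \<and> t \<le> v \<and> v - u < d \<longrightarrow> P u v" if "a \<le> t" "t \<le> b" for t
      using loc[of t] that unfolding P_def by (meson atLeastAtMost_iff)
  qed
  then show ?thesis by (simp add: P_def)
qed

lemma continuous_on_line:
  fixes x v :: "'a::locally_convex_space"
  shows "continuous_on S (\<lambda>t. x + t *\<^sub>R v)"
proof -
  have "((\<lambda>t. t *\<^sub>R v) \<longlongrightarrow> t0 *\<^sub>R v) (at t0 within S)" for t0
  proof -
    have "filterlim (\<lambda>t. (t, v)) (nhds t0 \<times>\<^sub>F nhds v) (at t0 within S)"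
      by (intro filterlim_Pair tendsto_const tendsto_ident_at)
    from filterlim_compose[OF tendsto_scaleR_Pair this] show ?thesis by simp
  qed
  then show ?thesis
    by (auto simp: continuous_on_def intro!: tendsto_add tendsto_const)
qed

lemma line_in_closed_segment:
  assumes "t \<in> {0..1::real}"
  shows "x + t *\<^sub>R (y - x) \<in> closed_segment x y"
  using assms by (auto simp: in_segment algebra_simps intro!: exI[of _ t])

lemma continuous_map_graph_along_segment:
  assumes cont: "continuous_on_segments \<tau> D T" and seg: "closed_segment x y \<subseteq> D"
  shows "continuous_map (top_of_set {0..1}) (prod_topology euclidean \<tau>)
           (\<lambda>t. (x + t *\<^sub>R (y - x), T (x + t *\<^sub>R (y - x))))"
proof -
  let ?\<gamma> = "\<lambda>t. x + t *\<^sub>R (y - x)"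
  have \<gamma>: "continuous_map (top_of_set {0..1}) euclidean ?\<gamma>"
    by (simp add: continuous_on_line)
  have "continuous_map (top_of_set {0..1}) (top_of_set (closed_segment x y)) ?\<gamma>"
    using \<gamma> line_in_closed_segment by (force simp: continuous_map_in_subtopology)
  moreover have "continuous_map (top_of_set (closed_segment x y)) \<tau> T"
    using cont seg by (simp add: continuous_on_segments_def)
  ultimately have "continuous_map (top_of_set {0..1}) \<tau> (T \<circ> ?\<gamma>)"
    by (rule continuous_map_compose)
  with \<gamma> show ?thesis
    by (simp add: continuous_map_pairedI o_def)
qed

text \<open>The difference of two points on the line is a nonnegative multiple of its direction, and
  a positive factor can be cancelled from the monotonicity inequality by linearity.\<close>

lemma monotone_graph_along_line:
  assumes "monotone_graph G"
    and "(x + u *\<^sub>R d, f) \<in> G" "(x + v *\<^sub>R d, g) \<in> G"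
    and "linear f" "linear g" "u \<le> v"
    \<comment> \<open>For \<open>u = v\<close> the two functionals need not agree unless they are values at the same point.\<close>
    and "u = v \<Longrightarrow> f = g"
  shows "f d \<le> g d"
proof (cases "u = v")
  case False
  have "(x + v *\<^sub>R d) - (x + u *\<^sub>R d) = (v - u) *\<^sub>R d"
    by (simp add: algebra_simps)
  moreover have "(g - f) ((x + v *\<^sub>R d) - (x + u *\<^sub>R d)) \<ge> 0"
    using assms(1-3) unfolding monotone_graph_def by blast
  ultimately have "g ((v - u) *\<^sub>R d) - f ((v - u) *\<^sub>R d) \<ge> 0"
    by simp
  then have "(v - u) * (g d - f d) \<ge> 0"
    using assms(4,5) by (simp add: linear_cmul right_diff_distrib)
  with False \<open>u \<le> v\<close> show ?thesis
    by (simp add: zero_le_mult_iff)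
qed (use assms(7) in simp)

text \<open>A neighbourhood of a point of the graph pulls back, along the continuous curve, to a
  neighbourhood of the parameter.\<close>

lemma locally_monotone_along_segment:
  assumes loc: "\<forall>u\<in>D. locally_monotone_around \<tau> D T (u, T u)"
    and lin: "\<And>z. z \<in> D \<Longrightarrow> linear (T z)"
    and cont: "continuous_on_segments \<tau> D T"
    and seg: "closed_segment x y \<subseteq> D"
    and t: "t \<in> {0..1}"
  shows "\<exists>e>0. \<forall>u v. 0 \<le> u \<and> u \<le> t \<and> t \<le> v \<and> v \<le> 1 \<and> v - u < e \<longrightarrow>
           T (x + u *\<^sub>R (y - x)) (y - x) \<le> T (x + v *\<^sub>R (y - x)) (y - x)"
proof -
  let ?\<gamma> = "\<lambda>t. x + t *\<^sub>R (y - x)"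
  have inD: "?\<gamma> s \<in> D" if "s \<in> {0..1}" for s
    using line_in_closed_segment[OF that] seg by blast
  obtain W where W: "openin (prod_topology euclidean \<tau>) W" "(?\<gamma> t, T (?\<gamma> t)) \<in> W"
      "monotone_graph (gph D T \<inter> W)"
    using loc inD[OF t] unfolding locally_monotone_around_def by blast
  let ?V = "{s \<in> {0..1}. (?\<gamma> s, T (?\<gamma> s)) \<in> W}"
  have "openin (top_of_set {0..1}) ?V"
    using openin_continuous_map_preimage[OF continuous_map_graph_along_segment[OF cont seg] W(1)]
    by simp
  moreover have "t \<in> ?V" using t W(2) by simp
  ultimately obtain e where e: "e > 0" "ball t e \<inter> {0..1} \<subseteq> ?V"
    by (meson openin_contains_ball)
  show ?thesis
  proof (intro exI[of _ e] conjI allI impI)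
    fix u v assume uv: "0 \<le> u \<and> u \<le> t \<and> t \<le> v \<and> v \<le> 1 \<and> v - u < e"
    then have "u \<in> ball t e \<inter> {0..1}" "v \<in> ball t e \<inter> {0..1}"
      by (auto simp: dist_real_def)
    with e have "u \<in> ?V" "v \<in> ?V" by blast+
    then show "T (?\<gamma> u) (y - x) \<le> T (?\<gamma> v) (y - x)"
      using uv inD lin by (intro monotone_graph_along_line[OF W(3)]) (auto simp: gph_def)
  qed (rule e(1))
qed

text \<open>The whole product space serves as neighbourhood.\<close>

lemma locally_monotone_around_if_globally_monotone:
  assumes "globally_monotone D T" and "u \<in> D" and "T u \<in> topspace \<tau>"
  shows "locally_monotone_around \<tau> D T (u, T u)"
  unfolding locally_monotone_around_def
proof (intro exI[of _ "topspace (prod_topology euclidean \<tau>)"] conjI)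
  show "monotone_graph (gph D T \<inter> topspace (prod_topology euclidean \<tau>))"
    using assms(1) by (auto simp: globally_monotone_def monotone_graph_def)
  show "(u, T u) \<in> topspace (prod_topology euclidean \<tau>)"
    using assms(3) by simp
qed (rule openin_topspace)

theorem theorem3p1:
  fixes D :: "'a::locally_convex_space set"
    and T :: "'a \<Rightarrow> 'a \<Rightarrow> real"
    and \<tau> :: "('a \<Rightarrow> real) topology"
  assumes "\<tau> = weak_star_topology \<or> \<tau> = strong_dual_topology"
    and "T \<in> D \<rightarrow> topological_dual"
    and "D \<noteq> {}"
    and "convex D"
    and "continuous_on_segments \<tau> D T"
  shows "(\<forall>u\<in>D. locally_monotone_around \<tau> D T (u, T u)) \<longleftrightarrow> globally_monotone D T"
proof
  assume loc: "\<forall>u\<in>D. locally_monotone_around \<tau> D T (u, T u)"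
  have lin: "linear (T z)" if "z \<in> D" for z
    using assms(2) that by (auto simp: topological_dual_def)
  have "(T y - T x) (y - x) \<ge> 0" if "x \<in> D" "y \<in> D" for x y
  proof -
    have seg: "closed_segment x y \<subseteq> D"
      using assms(4) that by (simp add: closed_segment_subset)
    have "T (x + 0 *\<^sub>R (y - x)) (y - x) \<le> T (x + 1 *\<^sub>R (y - x)) (y - x)"
      by (rule le_endpoints_if_locally_le[OF zero_le_one])
        (rule locally_monotone_along_segment[OF loc lin assms(5) seg])
    then show ?thesis by simp
  qed
  then show "globally_monotone D T"
    by (auto simp: globally_monotone_def monotone_graph_def gph_def)
next
  assume "globally_monotone D T"
  moreover have "topspace \<tau> = topological_dual"
    using assms(1) by auto
  ultimately show "\<forall>u\<in>D. locally_monotone_around \<tau> D T (u, T u)"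
    using assms(2) by (auto intro: locally_monotone_around_if_globally_monotone)
qed

end
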